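(* For every $k\ge 2$, the monoid $M_{k,1}$ is finitely generated.
   Context: Let $k\ge 2$ and $A=\{a_1,\dots,a_k\}$ an alphabet; $A^*$ is the set of all finite words over $A$, with empty word $\varepsilon$. A right ideal of $A^*$ is a set $R\subseteq A^*$ with $RA^*\subseteq R$ (the empty set is allowed). A prefix code is a set $C\subseteq A^*$ in which no element is a prefix of another element. Every right ideal $R$ equals $CA^*$ for a unique prefix code $C$; $R$ is finitely generated iff $C$ is finite. A right ideal homomorphism is a total function $\varphi: R_1\to A^*$, where $R_1={\rm Dom}(\varphi)$ is a right ideal, with $\varphi(xw)=\varphi(x)w$ for all $x\in R_1$, $w\in A^*$. For right ideals $R'\subseteq R$, $R'$ is essential in $R$ iff $R'$ intersects every non-empty right ideal contained in $R$. $\varphi$ is an essential extension of $\Phi$ iff ${\rm Dom}(\Phi)$ is contained and essential in ${\rm Dom}(\varphi)$ and $\varphi=\Phi$ on ${\rm Dom}(\Phi)$. Every right ideal homomorphism $\varphi$ with finitely generated domain has a unique maximal essential extension $\max(\varphi)$. $M_{k,1}$ is the monoid of all maximal essential extensions of right ideal homomorphisms between finitely generated right ideals of $A^*$, with multiplication $\varphi\cdot\psi=\max(\varphi\circ\psi)$. *)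

theory Defs
  imports "HOL-Algebra.Group" "HOL-Library.Sublist"
begin

text \<open>
  Words over an alphabet \<open>A\<close> are the elements of \<^term>\<open>lists A\<close>; partial functions on words are
  maps \<open>'a list \<Rightarrow> 'a list option\<close>, so that a map is determined by its domain and its values there.
\<close>

definition right_ideal :: "'a set \<Rightarrow> 'a list set \<Rightarrow> bool" where
  "right_ideal A R \<longleftrightarrow> R \<subseteq> lists A \<and> (\<forall>x\<in>R. \<forall>w\<in>lists A. x @ w \<in> R)"

definition prefix_code :: "'a set \<Rightarrow> 'a list set \<Rightarrow> bool" where
  "prefix_code A C \<longleftrightarrow> C \<subseteq> lists A \<and> (\<forall>x\<in>C. \<forall>y\<in>C. prefix x y \<longrightarrow> x = y)"

definition ideal_of :: "'a set \<Rightarrow> 'a list set \<Rightarrow> 'a list set" where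
  "ideal_of A C = {c @ w | c w. c \<in> C \<and> w \<in> lists A}"

definition fg_right_ideal :: "'a set \<Rightarrow> 'a list set \<Rightarrow> bool" where
  "fg_right_ideal A R \<longleftrightarrow> (\<exists>C. prefix_code A C \<and> finite C \<and> R = ideal_of A C)"

definition essential_in :: "'a set \<Rightarrow> 'a list set \<Rightarrow> 'a list set \<Rightarrow> bool" where
  "essential_in A R' R \<longleftrightarrow>
     R' \<subseteq> R \<and> (\<forall>S. right_ideal A S \<and> S \<noteq> {} \<and> S \<subseteq> R \<longrightarrow> R' \<inter> S \<noteq> {})"

definition right_ideal_hom :: "'a set \<Rightarrow> ('a list \<Rightarrow> 'a list option) \<Rightarrow> bool" where
  "right_ideal_hom A \<phi> \<longleftrightarrow>
     right_ideal A (dom \<phi>) \<and> ran \<phi> \<subseteq> lists A \<and>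
     (\<forall>x\<in>dom \<phi>. \<forall>w\<in>lists A. \<phi> (x @ w) = Some (the (\<phi> x) @ w))"

text \<open>\<open>essential_extension A \<phi> \<Phi>\<close>: \<open>\<phi>\<close> extends \<open>\<Phi>\<close>.\<close>

definition essential_extension ::
    "'a set \<Rightarrow> ('a list \<Rightarrow> 'a list option) \<Rightarrow> ('a list \<Rightarrow> 'a list option) \<Rightarrow> bool" where
  "essential_extension A \<phi> \<Phi> \<longleftrightarrow>
     right_ideal_hom A \<phi> \<and> right_ideal_hom A \<Phi> \<and>
     essential_in A (dom \<Phi>) (dom \<phi>) \<and> (\<forall>x\<in>dom \<Phi>. \<phi> x = \<Phi> x)"

definition maximal_essential_extension ::
    "'a set \<Rightarrow> ('a list \<Rightarrow> 'a list option) \<Rightarrow> ('a list \<Rightarrow> 'a list option) \<Rightarrow> bool" where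
  "maximal_essential_extension A \<psi> \<Phi> \<longleftrightarrow>
     essential_extension A \<psi> \<Phi> \<and>
     (\<forall>\<chi>. essential_extension A \<chi> \<Phi> \<and> \<psi> \<subseteq>\<^sub>m \<chi> \<longrightarrow> \<chi> = \<psi>)"

text \<open>Well-definedness is lemma \<open>ex1_maximal_essential_extension\<close> below.\<close>

definition max_ext ::
    "'a set \<Rightarrow> ('a list \<Rightarrow> 'a list option) \<Rightarrow> ('a list \<Rightarrow> 'a list option)" where
  "max_ext A \<Phi> = (THE \<psi>. maximal_essential_extension A \<psi> \<Phi>)"

definition M1 :: "'a set \<Rightarrow> ('a list \<Rightarrow> 'a list option) monoid" where
  "M1 A = \<lparr>
     carrier = {max_ext A \<phi> | \<phi>. right_ideal_hom A \<phi> \<and>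
                  fg_right_ideal A (dom \<phi>) \<and> fg_right_ideal A (ran \<phi>)},
     mult = (\<lambda>\<phi> \<psi>. max_ext A (\<phi> \<circ>\<^sub>m \<psi>)),
     one = Some |` lists A \<rparr>"

text \<open>HOL-Algebra's \<open>generate\<close> closes under inverses, hence a separate notion for monoids.\<close>

inductive_set submonoid_generated :: "('m, 'x) monoid_scheme \<Rightarrow> 'm set \<Rightarrow> 'm set"
  for G and S where
  one: "\<one>\<^bsub>G\<^esub> \<in> submonoid_generated G S"
| incl: "s \<in> S \<Longrightarrow> s \<in> submonoid_generated G S"
| mult: "x \<in> submonoid_generated G S \<Longrightarrow> y \<in> submonoid_generated G S \<Longrightarrow>
         x \<otimes>\<^bsub>G\<^esub> y \<in> submonoid_generated G S"

definition finitely_generated_monoid :: "('m, 'x) monoid_scheme \<Rightarrow> bool" where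
  "finitely_generated_monoid G \<longleftrightarrow>
     monoid G \<and> (\<exists>S. finite S \<and> S \<subseteq> carrier G \<and> submonoid_generated G S = carrier G)"

lemma fg_right_ideal_iff:
  "fg_right_ideal A R \<longleftrightarrow> (\<exists>C. C \<subseteq> lists A \<and> finite C \<and> R = ideal_of A C)"
proof
  assume "fg_right_ideal A R"
  then show "\<exists>C. C \<subseteq> lists A \<and> finite C \<and> R = ideal_of A C"
    unfolding fg_right_ideal_def prefix_code_def by blast
next
  assume "\<exists>C. C \<subseteq> lists A \<and> finite C \<and> R = ideal_of A C"
  then obtain C where C: "C \<subseteq> lists A" "finite C" "R = ideal_of A C" by blast
  define D where "D = {x \<in> C. \<forall>y\<in>C. prefix y x \<longrightarrow> y = x}"
  have ex: "\<exists>d\<in>D. prefix d c" if "c \<in> C" for c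
    using that
  proof (induction c rule: measure_induct_rule[where f = length])
    case (less c)
    show ?case
    proof (cases "c \<in> D")
      case False
      with less.prems obtain y where y: "y \<in> C" "strict_prefix y c"
        by (auto simp: D_def strict_prefix_def)
      then obtain d where "d \<in> D" "prefix d y"
        using less.IH prefix_length_less by blast
      with y show ?thesis by (meson prefix_order.less_imp_le prefix_order.trans)
    qed auto
  qed
  have "prefix_code A D" "finite D"
    using C by (auto simp: prefix_code_def D_def)
  moreover have "ideal_of A C \<subseteq> ideal_of A D"
  proof
    fix x assume "x \<in> ideal_of A C"
    then obtain c w where c: "c \<in> C" "w \<in> lists A" "x = c @ w"
      by (auto simp: ideal_of_def)
    obtain d v where d: "d \<in> D" "c = d @ v"
      using ex[OF c(1)] by (auto simp: prefix_def)
    have "v \<in> lists A" using c d C by auto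
    then show "x \<in> ideal_of A D"
      unfolding ideal_of_def using c d by (intro CollectI exI[of _ d] exI[of _ "v @ w"]) auto
  qed
  moreover have "ideal_of A D \<subseteq> ideal_of A C"
    by (auto simp: ideal_of_def D_def)
  ultimately show "fg_right_ideal A R"
    unfolding fg_right_ideal_def using C(3) by blast
qed

lemma essential_in_iff:
  assumes "right_ideal A R"
  shows "essential_in A R' R \<longleftrightarrow> R' \<subseteq> R \<and> (\<forall>x\<in>R. \<exists>w\<in>lists A. x @ w \<in> R')"
proof
  assume L: "essential_in A R' R"
  have "\<exists>w\<in>lists A. x @ w \<in> R'" if "x \<in> R" for x
  proof -
    let ?S = "{x @ w | w. w \<in> lists A}"
    have "right_ideal A ?S" "?S \<noteq> {}" "?S \<subseteq> R"
      using assms that by (auto simp: right_ideal_def)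
    with L have "R' \<inter> ?S \<noteq> {}" unfolding essential_in_def by blast
    then show ?thesis by blast
  qed
  with L show "R' \<subseteq> R \<and> (\<forall>x\<in>R. \<exists>w\<in>lists A. x @ w \<in> R')"
    by (simp add: essential_in_def)
next
  assume "R' \<subseteq> R \<and> (\<forall>x\<in>R. \<exists>w\<in>lists A. x @ w \<in> R')"
  then show "essential_in A R' R"
    unfolding essential_in_def right_ideal_def by blast
qed

lemma essential_extension_iff:
  "essential_extension A \<phi> \<Phi> \<longleftrightarrow>
     right_ideal_hom A \<phi> \<and> right_ideal_hom A \<Phi> \<and> \<Phi> \<subseteq>\<^sub>m \<phi> \<and>
     (\<forall>x\<in>dom \<phi>. \<exists>w\<in>lists A. x @ w \<in> dom \<Phi>)"
proof -
  have "\<Phi> \<subseteq>\<^sub>m \<phi> \<longleftrightarrow> dom \<Phi> \<subseteq> dom \<phi> \<and> (\<forall>x\<in>dom \<Phi>. \<phi> x = \<Phi> x)"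
    unfolding map_le_def by (metis domIff subsetI)
  moreover have "essential_in A (dom \<Phi>) (dom \<phi>) \<longleftrightarrow>
      dom \<Phi> \<subseteq> dom \<phi> \<and> (\<forall>x\<in>dom \<phi>. \<exists>w\<in>lists A. x @ w \<in> dom \<Phi>)"
    if "right_ideal_hom A \<phi>"
    using that by (intro essential_in_iff) (simp add: right_ideal_hom_def)
  ultimately show ?thesis unfolding essential_extension_def by blast
qed

lemma essential_extensions_agree:
  assumes "essential_extension A \<phi> \<Phi>" "essential_extension A \<psi> \<Phi>"
    and "\<phi> x = Some y" "\<psi> x = Some z"
  shows "y = z"
proof -
  obtain w where w: "w \<in> lists A" "x @ w \<in> dom \<Phi>"
    using assms(1,3) unfolding essential_extension_iff by (metis domI)
  have "\<phi> (x @ w) = Some (y @ w)" "\<psi> (x @ w) = Some (z @ w)"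
    using assms w(1) unfolding essential_extension_iff right_ideal_hom_def
    by (metis domI option.sel)+
  moreover have "\<phi> (x @ w) = \<psi> (x @ w)"
    using assms(1,2) w(2) by (simp add: essential_extension_def)
  ultimately show ?thesis by simp
qed

lemma ex1_maximal_essential_extension:
  assumes hom: "right_ideal_hom A \<Phi>"
  shows "\<exists>!\<psi>. maximal_essential_extension A \<psi> \<Phi>"
proof -
  let ?E = "\<lambda>\<phi>. essential_extension A \<phi> \<Phi>"
  define \<mu> where "\<mu> x = (if \<exists>\<phi> y. ?E \<phi> \<and> \<phi> x = Some y
    then Some (SOME y. \<exists>\<phi>. ?E \<phi> \<and> \<phi> x = Some y) else None)" for x
  have up: "\<mu> x = Some y" if "?E \<phi>" "\<phi> x = Some y" for \<phi> x y
  proof -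
    have "(SOME y. \<exists>\<phi>. ?E \<phi> \<and> \<phi> x = Some y) = y"
      by (rule some_equality) (use that essential_extensions_agree in blast)+
    with that show ?thesis unfolding \<mu>_def by auto
  qed
  have dn: "\<exists>\<phi>. ?E \<phi> \<and> \<phi> x = Some y" if *: "\<mu> x = Some y" for x y
  proof -
    obtain \<phi> z where z: "?E \<phi>" "\<phi> x = Some z"
      using * unfolding \<mu>_def by (metis option.distinct(1))
    with up[OF z] * show ?thesis by auto
  qed
  have refl: "?E \<Phi>"
    using hom unfolding essential_extension_iff by (auto intro!: bexI[of _ "[]"])
  have \<mu>_app: "\<mu> (x @ w) = Some (y @ w)" if *: "\<mu> x = Some y" "w \<in> lists A" for x y w
  proof -
    obtain \<phi> where p: "?E \<phi>" "\<phi> x = Some y" using dn *(1) by blast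
    then have "\<phi> (x @ w) = Some (y @ w)"
      using *(2) unfolding essential_extension_iff right_ideal_hom_def
      by (metis domI option.sel)
    with up p show ?thesis by blast
  qed
  have "dom \<mu> \<subseteq> lists A" "ran \<mu> \<subseteq> lists A"
  proof -
    show "dom \<mu> \<subseteq> lists A"
      using dn unfolding essential_extension_iff right_ideal_hom_def right_ideal_def
      by (metis domD domI subset_iff)
    show "ran \<mu> \<subseteq> lists A"
    proof
      fix y assume "y \<in> ran \<mu>"
      then obtain x where "\<mu> x = Some y" by (auto simp: ran_def)
      then obtain \<phi> where "?E \<phi>" "\<phi> x = Some y" using dn by blast
      then show "y \<in> lists A"
        unfolding essential_extension_iff right_ideal_hom_def by (meson ranI subsetD)
    qed
  qed
  then have "right_ideal_hom A \<mu>"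
    unfolding right_ideal_hom_def right_ideal_def using \<mu>_app by fastforce
  moreover have "\<Phi> \<subseteq>\<^sub>m \<mu>"
    using up[OF refl] by (auto simp: map_le_def)
  moreover have "\<forall>x\<in>dom \<mu>. \<exists>w\<in>lists A. x @ w \<in> dom \<Phi>"
  proof
    fix x assume "x \<in> dom \<mu>"
    then obtain \<phi> where "?E \<phi>" "x \<in> dom \<phi>" using dn by blast
    then show "\<exists>w\<in>lists A. x @ w \<in> dom \<Phi>" unfolding essential_extension_iff by blast
  qed
  ultimately have E\<mu>: "?E \<mu>" using hom by (simp add: essential_extension_iff)
  have le: "\<phi> \<subseteq>\<^sub>m \<mu>" if "?E \<phi>" for \<phi>
    using up[OF that] by (auto simp: map_le_def)
  show ?thesis
  proof (rule ex1I[of _ \<mu>])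
    show "maximal_essential_extension A \<mu> \<Phi>"
      using E\<mu> le map_le_antisym unfolding maximal_essential_extension_def by blast
    show "\<psi> = \<mu>" if "maximal_essential_extension A \<psi> \<Phi>" for \<psi>
      using that E\<mu> le unfolding maximal_essential_extension_def by metis
  qed
qed

end

theory Submission
  imports Defs
begin

text \<open>
  A homomorphism with finitely generated domain is a finite table of prefix replacements, and its
  maximal essential extension records exactly what the table does to long words: two such
  homomorphisms have the same maximal essential extension as soon as they agree on all sufficiently
  long words (\<open>max_ext_cong\<close>). Long words go to long words, so this agreement is compatible
  with composition, and \<open>M1 A\<close> is the monoid of tables under composition, taken modulo
  agreement on long words (\<open>mult_M1\<close>, \<open>monoid_M1\<close>).

  For a letter \<open>a\<close> let \<open>below A a \<phi>\<close> act as \<open>\<phi>\<close> below \<open>a\<close>, that is \<open>a x \<mapsto> a \<phi>(x)\<close>, and fix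
  every word that begins with another letter. Suppose that a set of tables, closed under composition
  and under agreement on long words, contains the identity, the empty table, all
  maps \<open>x \<mapsto> a x\<close>, and the map \<open>fold = branch A (\<lambda>_. ident A)\<close> that deletes the first letter, and
  is closed under all the operators \<open>below A a\<close>. Then it contains every table: a table that
  needs to see \<open>n + 1\<close> letters acts below each letter \<open>a\<close> as some \<open>F a\<close> that needs to see only \<open>n\<close>
  letters, and it is \<open>fold\<close> after the product of all \<open>below A a (F a)\<close>
  (\<open>branch_in_hom_closure\<close>).

  So it remains to find a finite set whose closure under composition is stable under \<open>below\<close>. Each
  \<open>below A a\<close> is multiplicative (\<open>below_comp\<close>), hence it suffices that \<open>below\<close> sends the
  generators into the closure. Let \<open>T\<close> be finite and let \<open>S\<close> consist of \<open>T\<close> and all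
  \<open>below A a s\<close> with \<open>s \<in> T\<close>. The only new elements are \<open>below A a (below A b s)\<close>, which act as
  \<open>s\<close> below the word \<open>a b\<close>. There is a table \<open>zoom_in\<close>, depending only on \<open>a\<close>, \<open>b\<close> and an auxiliary
  letter \<open>c \<noteq> a\<close>, that carries the words below \<open>a b\<close> onto those below \<open>a\<close> and moves all others away
  injectively; conjugating with it gives
  \<open>below A a (below A b s) = zoom_out \<circ> below A a s \<circ> zoom_in\<close> (\<open>below_below\<close>).
  Because the same two tables serve every \<open>s\<close>, they can themselves be put into \<open>T\<close>, and no
  further generators arise. A second letter is what leaves room outside \<open>a A*\<close>.
\<close>

section \<open>Homomorphisms with finitely generated domain\<close>

text \<open>
  Membership in the domain is settled by the first \<open>n\<close> letters. The number \<open>n\<close> is a depth for the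
  table of \<open>\<phi>\<close>, and it is the parameter of the final induction.
\<close>

definition decided_at :: "'a set \<Rightarrow> nat \<Rightarrow> ('a list \<Rightarrow> 'a list option) \<Rightarrow> bool" where
  "decided_at A n \<phi> \<longleftrightarrow> right_ideal_hom A \<phi> \<and>
     (\<forall>x\<in>lists A. \<forall>w\<in>lists A. n \<le> length x \<longrightarrow> x @ w \<in> dom \<phi> \<longrightarrow> x \<in> dom \<phi>)"

definition tame :: "'a set \<Rightarrow> ('a list \<Rightarrow> 'a list option) \<Rightarrow> bool" where
  "tame A \<phi> \<longleftrightarrow> (\<exists>n. decided_at A n \<phi>)"

definition ev_eq :: "'a set \<Rightarrow> ('a list \<Rightarrow> 'a list option) \<Rightarrow> ('a list \<Rightarrow> 'a list option) \<Rightarrow> bool" where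
  "ev_eq A \<phi> \<psi> \<longleftrightarrow> (\<exists>n. \<forall>x\<in>lists A. n \<le> length x \<longrightarrow> \<phi> x = \<psi> x)"

lemma finite_bounded: "finite B \<Longrightarrow> \<exists>n. \<forall>b\<in>B. f b \<le> (n::nat)"
  by (rule exI[of _ "Max (f ` B)"]) simp

text \<open>
  This form of the definition needs neither domains nor \<open>the\<close>, so that membership of
  arguments and values in \<open>lists A\<close> comes for free from a single equation.
\<close>

lemma right_ideal_hom_iff:
  "right_ideal_hom A \<phi> \<longleftrightarrow>
     (\<forall>x y. \<phi> x = Some y \<longrightarrow>
        x \<in> lists A \<and> y \<in> lists A \<and> (\<forall>w\<in>lists A. \<phi> (x @ w) = Some (y @ w)))"
  (is "?L \<longleftrightarrow> ?R")
proof
  assume L: ?L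
  show ?R
  proof (intro allI impI)
    fix x y assume xy: "\<phi> x = Some y"
    then show "x \<in> lists A \<and> y \<in> lists A \<and> (\<forall>w\<in>lists A. \<phi> (x @ w) = Some (y @ w))"
      using L unfolding right_ideal_hom_def right_ideal_def
      by (metis domI option.sel ranI subsetD)
  qed
next
  assume R: ?R
  show ?L
    unfolding right_ideal_hom_def right_ideal_def
  proof (intro conjI ballI)
    show "dom \<phi> \<subseteq> lists A" "ran \<phi> \<subseteq> lists A"
      using R by (blast, auto simp: ran_def)
  next
    fix x w assume "x \<in> dom \<phi>" "w \<in> lists A"
    then have "\<phi> (x @ w) = Some (the (\<phi> x) @ w)" using R by (metis domD option.sel)
    then show "x @ w \<in> dom \<phi>" "\<phi> (x @ w) = Some (the (\<phi> x) @ w)" by blast+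
  qed
qed

lemma homD:
  assumes "right_ideal_hom A \<phi>" "\<phi> x = Some y"
  shows "x \<in> lists A" "y \<in> lists A" "w \<in> lists A \<Longrightarrow> \<phi> (x @ w) = Some (y @ w)"
  using assms unfolding right_ideal_hom_iff by blast+

lemma decided_at_hom: "decided_at A n \<phi> \<Longrightarrow> right_ideal_hom A \<phi>"
  by (simp add: decided_at_def)

lemma decided_atD:
  assumes "decided_at A n \<phi>" "x @ w \<in> dom \<phi>" "n \<le> length x"
  shows "x \<in> dom \<phi>"
proof -
  have "x @ w \<in> lists A" using homD(1)[OF decided_at_hom[OF assms(1)]] assms(2) by blast
  then have "x \<in> lists A" "w \<in> lists A" by simp_all
  then show ?thesis using assms unfolding decided_at_def by blast
qed

lemma tame_hom: "tame A \<phi> \<Longrightarrow> right_ideal_hom A \<phi>"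
  by (auto simp: tame_def decided_at_def)

text \<open>
  If the domain is decided at depth \<open>n\<close>, its words of length at most \<open>n\<close> generate it, and there are
  finitely many of them. Conversely the maximal length of a generator is such a depth.
\<close>

lemma tame_iff_fg_dom:
  assumes A: "finite A"
  shows "tame A \<phi> \<longleftrightarrow> right_ideal_hom A \<phi> \<and> fg_right_ideal A (dom \<phi>)"
proof
  assume "tame A \<phi>"
  then obtain n where n: "decided_at A n \<phi>" by (auto simp: tame_def)
  note hom = decided_at_hom[OF n]
  let ?C = "{x \<in> dom \<phi>. length x \<le> n}"
  have sub: "dom \<phi> \<subseteq> lists A" using homD[OF hom] by blast
  have "?C \<subseteq> {xs. set xs \<subseteq> A \<and> length xs \<le> n}" using sub by auto
  then have "finite ?C" using finite_lists_length_le[OF A] finite_subset by blast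
  moreover have "dom \<phi> = ideal_of A ?C"
  proof (intro subset_antisym subsetI)
    fix x assume x: "x \<in> dom \<phi>"
    show "x \<in> ideal_of A ?C"
    proof (cases "length x \<le> n")
      case True
      with x have "x @ [] \<in> ideal_of A ?C" unfolding ideal_of_def by blast
      then show ?thesis by simp
    next
      case False
      have "take n x @ drop n x \<in> dom \<phi>" using x by simp
      then have "take n x @ drop n x \<in> lists A" using sub by blast
      then have l: "drop n x \<in> lists A" unfolding append_in_lists_conv by blast
      have "take n x \<in> dom \<phi>"
        using decided_atD[OF n, of "take n x" "drop n x"] x False by simp
      moreover have "length (take n x) \<le> n" by simp
      ultimately have "take n x @ drop n x \<in> ideal_of A ?C"
        using l unfolding ideal_of_def by blast
      then show ?thesis by simp
    qed
  next
    fix x assume "x \<in> ideal_of A ?C"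
    then obtain c w where c: "c \<in> dom \<phi>" "w \<in> lists A" "x = c @ w" by (auto simp: ideal_of_def)
    then show "x \<in> dom \<phi>" using homD(3)[OF hom _ c(2)] by blast
  qed
  moreover have "?C \<subseteq> lists A" using sub by blast
  ultimately have "\<exists>C. C \<subseteq> lists A \<and> finite C \<and> dom \<phi> = ideal_of A C"
    by (intro exI[of _ ?C] conjI)
  with hom show "right_ideal_hom A \<phi> \<and> fg_right_ideal A (dom \<phi>)"
    by (simp only: fg_right_ideal_iff simp_thms)
next
  assume R: "right_ideal_hom A \<phi> \<and> fg_right_ideal A (dom \<phi>)"
  then obtain C where C: "C \<subseteq> lists A" "finite C" "dom \<phi> = ideal_of A C"
    unfolding fg_right_ideal_iff by blast
  obtain n where n: "\<forall>c\<in>C. length c \<le> n"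
    using finite_bounded[OF C(2)] by blast
  have "x \<in> dom \<phi>" if x: "x \<in> lists A" "n \<le> length x" and xw: "x @ w \<in> dom \<phi>" for x w
  proof -
    obtain c v where c: "c \<in> C" "v \<in> lists A" "x @ w = c @ v"
      using xw C(3) by (auto simp: ideal_of_def)
    have "length c \<le> length x" using c(1) n x(2) by (meson order_trans)
    moreover have "take (length c) (x @ w) = c" using c(3) by simp
    ultimately have "take (length c) x = c" by simp
    then obtain u where u: "x = c @ u" by (metis append_take_drop_id)
    then have "u \<in> lists A" using x(1) by simp
    then show ?thesis using u c(1) unfolding C(3) ideal_of_def by blast
  qed
  then show "tame A \<phi>" using R unfolding tame_def decided_at_def by blast
qed

text \<open>
  Beyond the depth \<open>n\<close> the map only copies letters, so at most \<open>n\<close> letters are lost. This is why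
  long words stay long, both in \<open>tame_comp\<close> and in \<open>ev_eq_comp\<close>.
\<close>

lemma decided_at_length:
  assumes n: "decided_at A n \<phi>" and x: "\<phi> x = Some y" "n \<le> length x"
  shows "length x \<le> length y + n"
proof -
  have "x \<in> lists A" using homD(1)[OF decided_at_hom[OF n]] x by blast
  then have l: "take n x \<in> lists A" "drop n x \<in> lists A"
    by (metis append_in_lists_conv append_take_drop_id)+
  have "take n x \<in> dom \<phi>"
    using decided_atD[OF n, of "take n x" "drop n x"] x by (simp add: domI)
  then obtain z where "\<phi> (take n x) = Some z" by blast
  then have "\<phi> (take n x @ drop n x) = Some (z @ drop n x)"
    using homD(3)[OF decided_at_hom[OF n]] l by blast
  with x have "y = z @ drop n x" by simp
  then show ?thesis by simp
qed

lemma in_dom_map_comp: "x \<in> dom (\<phi> \<circ>\<^sub>m \<psi>) \<longleftrightarrow> (\<exists>y. \<psi> x = Some y \<and> y \<in> dom \<phi>)"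
  by (auto simp: map_comp_def split: option.splits)

lemma hom_comp:
  assumes "right_ideal_hom A \<phi>" "right_ideal_hom A \<psi>"
  shows "right_ideal_hom A (\<phi> \<circ>\<^sub>m \<psi>)"
  using assms unfolding right_ideal_hom_iff map_comp_Some_iff by blast

text \<open>
  The depth of a composite is at most the sum of the depths: the inner map may
  consume \<open>n\<close> letters and must still leave \<open>m\<close> letters for the outer one.
\<close>

lemma tame_comp:
  assumes "tame A \<phi>" "tame A \<psi>"
  shows "tame A (\<phi> \<circ>\<^sub>m \<psi>)"
proof -
  obtain m n where m: "decided_at A m \<phi>" and n: "decided_at A n \<psi>"
    using assms by (auto simp: tame_def)
  have "x \<in> dom (\<phi> \<circ>\<^sub>m \<psi>)"
    if x: "x \<in> lists A" "m + n \<le> length x" and w: "w \<in> lists A" "x @ w \<in> dom (\<phi> \<circ>\<^sub>m \<psi>)" for x w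
  proof -
    have "x @ w \<in> dom \<psi>" using w unfolding in_dom_map_comp by blast
    then have "x \<in> dom \<psi>" using decided_atD[OF n] x by simp
    then obtain y where y: "\<psi> x = Some y" by blast
    then have "\<psi> (x @ w) = Some (y @ w)" "y \<in> lists A"
      using homD[OF decided_at_hom[OF n]] w by blast+
    moreover from this have "y @ w \<in> dom \<phi>" using w by (simp add: in_dom_map_comp)
    moreover have "m \<le> length y" using decided_at_length[OF n y] x by simp
    ultimately have "y \<in> dom \<phi>" using decided_atD[OF m] by blast
    then show ?thesis using y unfolding in_dom_map_comp by blast
  qed
  then have "decided_at A (m + n) (\<phi> \<circ>\<^sub>m \<psi>)"
    using hom_comp decided_at_hom m n unfolding decided_at_def by blast
  then show ?thesis unfolding tame_def by blast
qed

section \<open>Eventual equality\<close>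

lemma ev_eq_refl: "ev_eq A \<phi> \<phi>"
  by (auto simp: ev_eq_def)

lemma ev_eq_sym: "ev_eq A \<phi> \<psi> \<Longrightarrow> ev_eq A \<psi> \<phi>"
  by (fastforce simp: ev_eq_def)

lemma ev_eq_trans:
  assumes "ev_eq A \<phi> \<psi>" "ev_eq A \<psi> \<chi>"
  shows "ev_eq A \<phi> \<chi>"
proof -
  obtain m n where "\<forall>x\<in>lists A. m \<le> length x \<longrightarrow> \<phi> x = \<psi> x"
    "\<forall>x\<in>lists A. n \<le> length x \<longrightarrow> \<psi> x = \<chi> x"
    using assms by (auto simp: ev_eq_def)
  then have "\<forall>x\<in>lists A. max m n \<le> length x \<longrightarrow> \<phi> x = \<chi> x" by simp
  then show ?thesis unfolding ev_eq_def by blast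
qed

lemma ev_eq_comp:
  assumes "ev_eq A \<phi> \<phi>'" "ev_eq A \<psi> \<psi>'" "tame A \<psi>"
  shows "ev_eq A (\<phi> \<circ>\<^sub>m \<psi>) (\<phi>' \<circ>\<^sub>m \<psi>')"
proof -
  obtain m n l where m: "\<forall>x\<in>lists A. m \<le> length x \<longrightarrow> \<phi> x = \<phi>' x"
    and n: "\<forall>x\<in>lists A. n \<le> length x \<longrightarrow> \<psi> x = \<psi>' x"
    and l: "decided_at A l \<psi>"
    using assms by (auto simp: ev_eq_def tame_def)
  have "(\<phi> \<circ>\<^sub>m \<psi>) x = (\<phi>' \<circ>\<^sub>m \<psi>') x" if x: "x \<in> lists A" "m + n + l \<le> length x" for x
  proof (cases "\<psi> x")
    case None
    then show ?thesis using n x by (simp add: map_comp_def)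
  next
    case (Some y)
    then have "y \<in> lists A" "length x \<le> length y + l"
      using homD[OF decided_at_hom[OF l]] decided_at_length[OF l] x by auto
    then have "\<phi> y = \<phi>' y" using m x by auto
    moreover have "\<psi>' x = Some y" using n x Some by auto
    ultimately show ?thesis using Some by (simp add: map_comp_def)
  qed
  then show ?thesis unfolding ev_eq_def by blast
qed

section \<open>Maximal essential extensions\<close>

lemma max_ext_maximal:
  "right_ideal_hom A \<phi> \<Longrightarrow> maximal_essential_extension A (max_ext A \<phi>) \<phi>"
  unfolding max_ext_def by (rule theI'[OF ex1_maximal_essential_extension])

lemma max_ext_essential:
  "right_ideal_hom A \<phi> \<Longrightarrow> essential_extension A (max_ext A \<phi>) \<phi>"
  using max_ext_maximal unfolding maximal_essential_extension_def by blast

lemma max_ext_eqI: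
  assumes "maximal_essential_extension A \<psi> \<phi>"
  shows "max_ext A \<phi> = \<psi>"
proof -
  have "right_ideal_hom A \<phi>"
    using assms by (simp add: maximal_essential_extension_def essential_extension_def)
  then show ?thesis
    unfolding max_ext_def using assms by (intro the1_equality ex1_maximal_essential_extension)
qed

lemma essential_extension_trans:
  assumes "essential_extension A \<psi> \<phi>" "essential_extension A \<chi> \<psi>"
  shows "essential_extension A \<chi> \<phi>"
proof -
  have "\<exists>w\<in>lists A. x @ w \<in> dom \<phi>" if "x \<in> dom \<chi>" for x
  proof -
    obtain w where w: "w \<in> lists A" "x @ w \<in> dom \<psi>"
      using assms(2) \<open>x \<in> dom \<chi>\<close> unfolding essential_extension_iff by blast
    then obtain v where "v \<in> lists A" "(x @ w) @ v \<in> dom \<phi>"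
      using assms(1) unfolding essential_extension_iff by blast
    then show ?thesis using w by (intro bexI[of _ "w @ v"]) auto
  qed
  then show ?thesis
    using assms map_le_trans unfolding essential_extension_iff by blast
qed

text \<open>
  An essential extension adds only words that have a continuation in the old domain; past the depth
  of \<open>\<phi>\<close> such words already belong to the old domain.
\<close>

lemma essential_extension_tame:
  assumes "tame A \<phi>" "essential_extension A \<psi> \<phi>"
  shows "tame A \<psi>" "ev_eq A \<psi> \<phi>"
proof -
  obtain n where n: "decided_at A n \<phi>" using assms by (auto simp: tame_def)
  have le: "\<phi> \<subseteq>\<^sub>m \<psi>" and hom: "right_ideal_hom A \<psi>"
    and dense: "\<forall>x\<in>dom \<psi>. \<exists>w\<in>lists A. x @ w \<in> dom \<phi>"
    using assms(2) unfolding essential_extension_iff by auto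
  have *: "x \<in> dom \<phi>" if x: "n \<le> length x" and xw: "x @ w \<in> dom \<psi>" for x w
  proof -
    obtain v where "(x @ w) @ v \<in> dom \<phi>" using dense xw by blast
    then show ?thesis using decided_atD[OF n, of x "w @ v"] x by simp
  qed
  moreover have "dom \<phi> \<subseteq> dom \<psi>" using le by (rule map_le_implies_dom_le)
  ultimately have "decided_at A n \<psi>"
    using hom unfolding decided_at_def by blast
  then show "tame A \<psi>" unfolding tame_def by blast
  have "\<psi> x = \<phi> x" if "n \<le> length x" for x
  proof (cases "x \<in> dom \<phi>")
    case True
    then show ?thesis using le by (simp add: map_le_def)
  next
    case False
    then have "x \<notin> dom \<psi>" using *[of x "[]"] that by auto
    with False show ?thesis by (simp add: domIff)
  qed
  then show "ev_eq A \<psi> \<phi>" unfolding ev_eq_def by blast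
qed

lemma max_ext_tame:
  assumes "tame A \<phi>"
  shows "tame A (max_ext A \<phi>)" "ev_eq A (max_ext A \<phi>) \<phi>"
  using essential_extension_tame[OF assms] max_ext_essential[OF tame_hom[OF assms]] by blast+

text \<open>
  Both maximal essential extensions restrict to the same homomorphism on words of length at least
  some \<open>n\<close>. That restriction is essential in each of them, because any word can be lengthened,
  and hence each of them is its unique maximal essential extension.
\<close>

lemma max_ext_cong:
  assumes A: "A \<noteq> {}" and \<phi>: "tame A \<phi>" and \<psi>: "tame A \<psi>" and eq: "ev_eq A \<phi> \<psi>"
  shows "max_ext A \<phi> = max_ext A \<psi>"
proof -
  let ?\<mu> = "max_ext A \<phi>" and ?\<nu> = "max_ext A \<psi>"
  have "ev_eq A ?\<mu> ?\<nu>"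
    using max_ext_tame[OF \<phi>] max_ext_tame[OF \<psi>] eq ev_eq_sym ev_eq_trans by blast
  then obtain n where n: "\<forall>x\<in>lists A. n \<le> length x \<longrightarrow> ?\<mu> x = ?\<nu> x"
    by (auto simp: ev_eq_def)
  have max: "maximal_essential_extension A (max_ext A \<theta>) (max_ext A \<theta> |` {x. n \<le> length x})"
    if "tame A \<theta>" for \<theta>
  proof -
    let ?\<chi> = "max_ext A \<theta> |` {x. n \<le> length x}"
    note M = max_ext_maximal[OF tame_hom[OF that]]
    note E = max_ext_essential[OF tame_hom[OF that]]
    have hom: "right_ideal_hom A (max_ext A \<theta>)" using E by (simp add: essential_extension_def)
    then have hom\<chi>: "right_ideal_hom A ?\<chi>"
      unfolding right_ideal_hom_iff by (auto simp: restrict_map_def split: if_splits)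
    obtain a where "a \<in> A" using A by blast
    then have rep: "replicate n a \<in> lists A" by auto
    have "essential_extension A (max_ext A \<theta>) ?\<chi>"
      unfolding essential_extension_iff using hom hom\<chi>
    proof (intro conjI ballI)
      fix x assume "x \<in> dom (max_ext A \<theta>)"
      then have "x @ replicate n a \<in> dom ?\<chi>"
        using homD(3)[OF hom _ rep] by auto
      then show "\<exists>w\<in>lists A. x @ w \<in> dom ?\<chi>" using rep by blast
    qed (auto simp: map_le_def)
    moreover have "\<xi> = max_ext A \<theta>"
      if "essential_extension A \<xi> ?\<chi>" "max_ext A \<theta> \<subseteq>\<^sub>m \<xi>" for \<xi>
    proof -
      have "dom ?\<chi> \<subseteq> dom (max_ext A \<theta>)" by auto
      then have "essential_extension A \<xi> (max_ext A \<theta>)"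
        using that hom unfolding essential_extension_iff by blast
      then have "essential_extension A \<xi> \<theta>"
        using E essential_extension_trans by blast
      then show ?thesis using M that unfolding maximal_essential_extension_def by blast
    qed
    ultimately show ?thesis unfolding maximal_essential_extension_def by blast
  qed
  have "?\<mu> |` {x. n \<le> length x} = ?\<nu> |` {x. n \<le> length x}"
  proof
    fix x
    have "?\<mu> x = None \<and> ?\<nu> x = None" if "x \<notin> lists A"
      using that homD(1) tame_hom max_ext_tame(1) \<phi> \<psi> by (metis not_Some_eq)
    then show "(?\<mu> |` {x. n \<le> length x}) x = (?\<nu> |` {x. n \<le> length x}) x"
      using n by (cases "x \<in> lists A") (auto simp: restrict_map_def)
  qed
  then show ?thesis using max[OF \<phi>] max[OF \<psi>] max_ext_eqI by metis
qed

section \<open>The monoid\<close>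

abbreviation ident :: "'a set \<Rightarrow> 'a list \<Rightarrow> 'a list option" where
  "ident A \<equiv> Some |` lists A"

lemma hom_ident_comp:
  assumes "right_ideal_hom A \<phi>"
  shows "ident A \<circ>\<^sub>m \<phi> = \<phi>" "\<phi> \<circ>\<^sub>m ident A = \<phi>"
proof -
  show "ident A \<circ>\<^sub>m \<phi> = \<phi>"
    using homD(2)[OF assms] by (auto simp: map_comp_def restrict_map_def fun_eq_iff split: option.split)
  show "\<phi> \<circ>\<^sub>m ident A = \<phi>"
  proof
    fix x
    show "(\<phi> \<circ>\<^sub>m ident A) x = \<phi> x"
      using homD(1)[OF assms, of x]
      by (cases "x \<in> lists A"; cases "\<phi> x") (auto simp: map_comp_def restrict_map_def)
  qed
qed

lemma map_comp_assoc: "(\<phi> \<circ>\<^sub>m \<psi>) \<circ>\<^sub>m \<chi> = \<phi> \<circ>\<^sub>m (\<psi> \<circ>\<^sub>m \<chi>)"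
  by (auto simp: map_comp_def fun_eq_iff split: option.split)

lemma tame_ident: "tame A (ident A)"
  unfolding tame_def decided_at_def right_ideal_hom_iff
  by (auto simp: restrict_map_def split: if_splits)

lemma max_ext_ident: "max_ext A (ident A) = ident A"
proof (rule map_le_antisym)
  have E: "essential_extension A (max_ext A (ident A)) (ident A)"
    by (rule max_ext_essential[OF tame_hom[OF tame_ident]])
  then show le: "ident A \<subseteq>\<^sub>m max_ext A (ident A)" by (simp add: essential_extension_iff)
  have "right_ideal_hom A (max_ext A (ident A))"
    using E by (simp add: essential_extension_def)
  then have dom: "x \<in> dom (ident A)" if "x \<in> dom (max_ext A (ident A))" for x
    using homD(1) that by fastforce
  show "max_ext A (ident A) \<subseteq>\<^sub>m ident A"
    unfolding map_le_def by (rule ballI, rule sym, rule bspec[OF le[unfolded map_le_def] dom])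
qed

text \<open>
  The images of the generators of the domain generate the range, so the carrier of \<open>M1 A\<close> is
  described by domains alone.
\<close>

lemma fg_ran:
  assumes "right_ideal_hom A \<phi>" "fg_right_ideal A (dom \<phi>)"
  shows "fg_right_ideal A (ran \<phi>)"
proof -
  obtain C where C: "C \<subseteq> lists A" "finite C" "dom \<phi> = ideal_of A C"
    using assms unfolding fg_right_ideal_iff by blast
  let ?D = "(\<lambda>c. the (\<phi> c)) ` C"
  have D: "\<phi> c = Some (the (\<phi> c))" if "c \<in> C" for c
  proof -
    have "c @ [] \<in> ideal_of A C" using that unfolding ideal_of_def by blast
    then have "c \<in> dom \<phi>" using C(3) by simp
    then show ?thesis by auto
  qed
  have "ran \<phi> = ideal_of A ?D"
  proof (intro subset_antisym subsetI)
    fix y assume "y \<in> ran \<phi>"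
    then obtain x where x: "\<phi> x = Some y" by (auto simp: ran_def)
    then obtain c w where "c \<in> C" "w \<in> lists A" "x = c @ w"
      using C(3) unfolding ideal_of_def by blast
    then have "y = the (\<phi> c) @ w" using homD(3)[OF assms(1) D] x by auto
    then show "y \<in> ideal_of A ?D"
      using \<open>c \<in> C\<close> \<open>w \<in> lists A\<close> unfolding ideal_of_def by blast
  next
    fix y assume "y \<in> ideal_of A ?D"
    then obtain c w where c: "c \<in> C" "w \<in> lists A" "y = the (\<phi> c) @ w"
      by (auto simp: ideal_of_def)
    then have "\<phi> (c @ w) = Some y" using homD(3)[OF assms(1) D] by auto
    then show "y \<in> ran \<phi>" by (rule ranI)
  qed
  moreover have "?D \<subseteq> lists A" using D homD(2)[OF assms(1)] by blast
  ultimately show ?thesis using C(2) unfolding fg_right_ideal_iff by blast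
qed

lemma carrier_M1:
  assumes "finite A"
  shows "carrier (M1 A) = {max_ext A \<phi> | \<phi>. tame A \<phi>}"
proof -
  have "right_ideal_hom A \<phi> \<and> fg_right_ideal A (dom \<phi>) \<and> fg_right_ideal A (ran \<phi>) \<longleftrightarrow> tame A \<phi>" for \<phi>
    using fg_ran[of A \<phi>] tame_iff_fg_dom[OF assms, of \<phi>] by blast
  then show ?thesis by (simp add: M1_def)
qed

lemma one_M1: "\<one>\<^bsub>M1 A\<^esub> = max_ext A (ident A)"
  by (simp add: M1_def max_ext_ident)

text \<open>
  Multiplication can be computed on any representatives; this turns the monoid laws into those of
  composition.
\<close>

lemma mult_M1:
  assumes "A \<noteq> {}" "tame A \<phi>" "tame A \<psi>"
  shows "max_ext A \<phi> \<otimes>\<^bsub>M1 A\<^esub> max_ext A \<psi> = max_ext A (\<phi> \<circ>\<^sub>m \<psi>)"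
proof -
  have "max_ext A \<phi> \<otimes>\<^bsub>M1 A\<^esub> max_ext A \<psi> = max_ext A (max_ext A \<phi> \<circ>\<^sub>m max_ext A \<psi>)"
    by (simp add: M1_def)
  also have "\<dots> = max_ext A (\<phi> \<circ>\<^sub>m \<psi>)"
    using assms by (intro max_ext_cong tame_comp ev_eq_comp max_ext_tame)
  finally show ?thesis .
qed

lemma monoid_M1:
  assumes "finite A" "A \<noteq> {}"
  shows "monoid (M1 A)"
proof
  fix x y assume "x \<in> carrier (M1 A)" "y \<in> carrier (M1 A)"
  then obtain \<phi> \<psi> where *: "tame A \<phi>" "x = max_ext A \<phi>" "tame A \<psi>" "y = max_ext A \<psi>"
    by (auto simp: carrier_M1[OF assms(1)])
  then have "x \<otimes>\<^bsub>M1 A\<^esub> y = max_ext A (\<phi> \<circ>\<^sub>m \<psi>)" using mult_M1[OF assms(2)] by simp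
  then show "x \<otimes>\<^bsub>M1 A\<^esub> y \<in> carrier (M1 A)"
    using tame_comp[OF *(1,3)] by (auto simp: carrier_M1[OF assms(1)])
next
  fix x y z
  assume "x \<in> carrier (M1 A)" "y \<in> carrier (M1 A)" "z \<in> carrier (M1 A)"
  then show "x \<otimes>\<^bsub>M1 A\<^esub> y \<otimes>\<^bsub>M1 A\<^esub> z = x \<otimes>\<^bsub>M1 A\<^esub> (y \<otimes>\<^bsub>M1 A\<^esub> z)"
    by (auto simp: carrier_M1[OF assms(1)] mult_M1[OF assms(2)] tame_comp map_comp_assoc)
next
  show "\<one>\<^bsub>M1 A\<^esub> \<in> carrier (M1 A)"
    using assms tame_ident by (auto simp: carrier_M1 one_M1)
next
  fix x assume "x \<in> carrier (M1 A)"
  then show "\<one>\<^bsub>M1 A\<^esub> \<otimes>\<^bsub>M1 A\<^esub> x = x" "x \<otimes>\<^bsub>M1 A\<^esub> \<one>\<^bsub>M1 A\<^esub> = x"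
    by (auto simp: carrier_M1[OF assms(1)] one_M1 mult_M1[OF assms(2)] tame_ident hom_ident_comp
        tame_hom)
qed

section \<open>Branching on the first letter\<close>

definition prepend :: "'a set \<Rightarrow> 'a list \<Rightarrow> 'a list \<Rightarrow> 'a list option" where
  "prepend A u = (\<lambda>x. Some (u @ x)) |` lists A"

definition branch :: "'a set \<Rightarrow> ('a \<Rightarrow> 'a list \<Rightarrow> 'a list option) \<Rightarrow> 'a list \<Rightarrow> 'a list option" where
  "branch A F x = (case x of [] \<Rightarrow> None | a # y \<Rightarrow> if a \<in> A then F a y else None)"

lemma ident_eq_prepend: "ident A = prepend A []"
  by (simp add: prepend_def)

lemma branch_simps [simp]:
  "branch A F [] = None"
  "branch A F (a # y) = (if a \<in> A then F a y else None)"
  by (simp_all add: branch_def)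

lemma tame_empty: "tame A Map.empty"
  by (auto simp: tame_def decided_at_def right_ideal_hom_iff)

lemma tame_prepend: "u \<in> lists A \<Longrightarrow> tame A (prepend A u)"
  unfolding tame_def decided_at_def right_ideal_hom_iff prepend_def
  by (auto simp: restrict_map_def split: if_splits)

lemma hom_branch:
  assumes "\<And>a. a \<in> A \<Longrightarrow> right_ideal_hom A (F a)"
  shows "right_ideal_hom A (branch A F)"
  unfolding right_ideal_hom_iff
proof (intro allI impI)
  fix x y assume xy: "branch A F x = Some y"
  then obtain a z where x: "x = a # z" "a \<in> A" "F a z = Some y"
    by (cases x) (auto split: if_splits)
  show "x \<in> lists A \<and> y \<in> lists A \<and> (\<forall>w\<in>lists A. branch A F (x @ w) = Some (y @ w))"
    using x homD[OF assms[OF x(2)] x(3)] by auto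
qed

lemma tame_branch:
  assumes "finite A" "\<And>a. a \<in> A \<Longrightarrow> tame A (F a)"
  shows "tame A (branch A F)"
proof -
  obtain N where N: "\<And>a. a \<in> A \<Longrightarrow> decided_at A (N a) (F a)"
    using assms(2) unfolding tame_def by metis
  obtain n where n: "\<forall>a\<in>A. N a \<le> n"
    using finite_bounded[OF assms(1)] by blast
  have "x \<in> dom (branch A F)"
    if hyps: "x \<in> lists A" "Suc n \<le> length x" "x @ w \<in> dom (branch A F)" for x w
  proof -
    obtain a y where x: "x = a # y" "a \<in> A" using hyps(1,2) by (cases x) auto
    then have "N a \<le> n" "n \<le> length y" "y @ w \<in> dom (F a)"
      using hyps n by (auto simp: dom_def)
    then have "y \<in> dom (F a)" using decided_atD[OF N[OF x(2)]] by simp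
    then show ?thesis using x by auto
  qed
  then have "decided_at A (Suc n) (branch A F)"
    using hom_branch[of A F] tame_hom assms(2) unfolding decided_at_def by blast
  then show ?thesis unfolding tame_def by blast
qed

lemma comp_branch: "\<phi> \<circ>\<^sub>m branch A F = branch A (\<lambda>a. \<phi> \<circ>\<^sub>m F a)"
  by (auto simp: fun_eq_iff map_comp_def branch_def split: list.split)

lemma branch_comp_prepend:
  assumes "a \<in> A"
  shows "branch A F \<circ>\<^sub>m prepend A (a # u) = F a \<circ>\<^sub>m prepend A u"
  using assms by (auto simp: fun_eq_iff map_comp_def prepend_def restrict_map_def)

lemma prepend_comp_prepend: "v \<in> lists A \<Longrightarrow> prepend A u \<circ>\<^sub>m prepend A v = prepend A (u @ v)"
  by (auto simp: fun_eq_iff map_comp_def prepend_def restrict_map_def)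

lemma branch_cong:
  "(\<And>a. a \<in> A \<Longrightarrow> F a = G a) \<Longrightarrow> branch A F = branch A G"
  by (auto simp: fun_eq_iff branch_def split: list.split)

lemma ev_eq_branch:
  assumes "finite A" "\<And>a. a \<in> A \<Longrightarrow> ev_eq A (F a) (G a)"
  shows "ev_eq A (branch A F) (branch A G)"
proof -
  obtain N where N: "\<And>a x. a \<in> A \<Longrightarrow> x \<in> lists A \<Longrightarrow> N a \<le> length x \<Longrightarrow> F a x = G a x"
    using assms(2) unfolding ev_eq_def by metis
  obtain n where n: "\<forall>a\<in>A. N a \<le> n"
    using finite_bounded[OF assms(1)] by blast
  have "branch A F x = branch A G x" if "x \<in> lists A" "Suc n \<le> length x" for x
    using that N n by (cases x) (auto intro: order_trans)
  then show ?thesis unfolding ev_eq_def by blast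
qed

text \<open>
  Only equality on long words can hold here, since \<open>\<phi>\<close> may be defined on the empty word.
\<close>

lemma ev_eq_branch_tails: "ev_eq A \<phi> (branch A (\<lambda>a x. \<phi> (a # x)))"
  unfolding ev_eq_def
proof (intro exI[of _ 1] ballI impI)
  fix x assume "x \<in> lists A" "1 \<le> length x"
  then show "\<phi> x = branch A (\<lambda>a x. \<phi> (a # x)) x" by (cases x) auto
qed

lemma decided_at_tail:
  assumes "decided_at A (Suc n) \<phi>" "a \<in> A"
  shows "decided_at A n (\<lambda>x. \<phi> (a # x))"
proof -
  have hom: "right_ideal_hom A (\<lambda>x. \<phi> (a # x))"
    unfolding right_ideal_hom_iff
  proof (intro allI impI)
    fix x y assume "\<phi> (a # x) = Some y"
    from homD[OF decided_at_hom[OF assms(1)] this]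
    show "x \<in> lists A \<and> y \<in> lists A \<and> (\<forall>w\<in>lists A. \<phi> (a # x @ w) = Some (y @ w))" by simp
  qed
  have "x \<in> dom (\<lambda>x. \<phi> (a # x))" if "n \<le> length x" "x @ w \<in> dom (\<lambda>x. \<phi> (a # x))" for x w
    using decided_atD[OF assms(1), of "a # x" w] that by (simp add: domIff)
  then show ?thesis using hom unfolding decided_at_def by blast
qed

text \<open>
  At depth \<open>0\<close> the domain is empty or contains the empty word, whose image is then the word that is
  prepended.
\<close>

lemma decided_at_0:
  assumes "decided_at A 0 \<phi>"
  shows "\<phi> = Map.empty \<or> (\<exists>u\<in>lists A. \<phi> = prepend A u)"
proof (cases "\<phi> []")
  case None
  have "\<phi> x = None" for x
  proof (rule ccontr)
    assume "\<phi> x \<noteq> None"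
    then have "[] @ x \<in> dom \<phi>" "x \<in> lists A"
      using homD(1)[OF decided_at_hom[OF assms]] by auto
    then have "[] \<in> dom \<phi>" using assms unfolding decided_at_def by blast
    with None show False by auto
  qed
  then show ?thesis by auto
next
  case (Some u)
  have "\<phi> = prepend A u"
  proof
    fix x show "\<phi> x = prepend A u x"
    using homD(3)[OF decided_at_hom[OF assms] Some, of x] homD(1)[OF decided_at_hom[OF assms], of x]
    by (cases "x \<in> lists A"; cases "\<phi> x") (auto simp: prepend_def restrict_map_def)
  qed
  then show ?thesis using homD(2)[OF decided_at_hom[OF assms] Some] by auto
qed

section \<open>Acting below one letter\<close>

definition below :: "'a set \<Rightarrow> 'a \<Rightarrow> ('a list \<Rightarrow> 'a list option) \<Rightarrow> 'a list \<Rightarrow> 'a list option" where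
  "below A a \<phi> = branch A (\<lambda>b. if b = a then prepend A [a] \<circ>\<^sub>m \<phi> else prepend A [b])"

text \<open>
  As a table, \<open>zoom_in\<close> consists of the rows \<open>a b \<mapsto> a\<close>, \<open>a e \<mapsto> c a e\<close> for \<open>e \<noteq> b\<close>, and
  \<open>d \<mapsto> c c d\<close> for \<open>d \<noteq> a\<close>; when \<open>c \<noteq> a\<close>, the other words of the domain all leave \<open>a A*\<close>.
  The second letter \<open>a\<close> or \<open>c\<close> of their images remembers which kind of row was used, so that
  \<open>zoom_out\<close>, with the rows \<open>a \<mapsto> a b\<close>, \<open>c a \<mapsto> a\<close> and \<open>c c \<mapsto> \<epsilon>\<close>, is a left inverse.
\<close>

definition zoom_in :: "'a set \<Rightarrow> 'a \<Rightarrow> 'a \<Rightarrow> 'a \<Rightarrow> 'a list \<Rightarrow> 'a list option" where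
  "zoom_in A a b c = branch A (\<lambda>d. if d = a
      then branch A (\<lambda>e. if e = b then prepend A [a] else prepend A [c, a, e])
      else prepend A [c, c, d])"

definition zoom_out :: "'a set \<Rightarrow> 'a \<Rightarrow> 'a \<Rightarrow> 'a \<Rightarrow> 'a list \<Rightarrow> 'a list option" where
  "zoom_out A a b c = branch A (\<lambda>d. if d = a then prepend A [a, b]
      else if d = c then branch A (\<lambda>e. if e = a then prepend A [a]
        else if e = c then prepend A [] else Map.empty)
      else Map.empty)"

lemma tame_below:
  "finite A \<Longrightarrow> tame A \<phi> \<Longrightarrow> tame A (below A a \<phi>)"
  unfolding below_def by (auto intro!: tame_branch tame_comp tame_prepend)

lemma tame_zoom:
  assumes "finite A" "a \<in> A" "b \<in> A" "c \<in> A"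
  shows "tame A (zoom_in A a b c)" "tame A (zoom_out A a b c)"
  using assms unfolding zoom_in_def zoom_out_def
  by (auto intro!: tame_branch tame_prepend tame_empty)

lemma below_comp_prepend:
  assumes "a \<in> A" "b \<in> A" "u \<in> lists A"
  shows "below A a \<phi> \<circ>\<^sub>m prepend A (b # u) =
    (if b = a then prepend A [a] \<circ>\<^sub>m \<phi> \<circ>\<^sub>m prepend A u else prepend A (b # u))"
  using assms by (simp add: below_def branch_comp_prepend prepend_comp_prepend)

lemma prepend_comp_prepend_comp:
  "v \<in> lists A \<Longrightarrow> prepend A u \<circ>\<^sub>m (prepend A v \<circ>\<^sub>m \<phi>) = prepend A (u @ v) \<circ>\<^sub>m \<phi>"
  by (simp flip: map_comp_assoc add: prepend_comp_prepend)

text \<open>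
  The two maps meet only below \<open>a\<close>, where the letter added by the inner one is read by the outer.
\<close>

lemma below_comp:
  assumes "a \<in> A" "right_ideal_hom A \<phi>" "right_ideal_hom A \<psi>"
  shows "below A a (\<phi> \<circ>\<^sub>m \<psi>) = below A a \<phi> \<circ>\<^sub>m below A a \<psi>"
proof -
  have "below A a \<phi> \<circ>\<^sub>m below A a \<psi> =
    branch A (\<lambda>b. below A a \<phi> \<circ>\<^sub>m (if b = a then prepend A [a] \<circ>\<^sub>m \<psi> else prepend A [b]))"
    by (simp add: below_def[of A a \<psi>] comp_branch)
  also have "\<dots> = below A a (\<phi> \<circ>\<^sub>m \<psi>)"
    unfolding below_def[of A a "\<phi> \<circ>\<^sub>m \<psi>"]
  proof (rule branch_cong)
    fix b assume "b \<in> A"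
    have "below A a \<phi> \<circ>\<^sub>m (prepend A [a] \<circ>\<^sub>m \<psi>) = prepend A [a] \<circ>\<^sub>m (\<phi> \<circ>\<^sub>m ident A \<circ>\<^sub>m \<psi>)"
      using assms by (simp flip: map_comp_assoc add: below_comp_prepend ident_eq_prepend)
    then show "below A a \<phi> \<circ>\<^sub>m (if b = a then prepend A [a] \<circ>\<^sub>m \<psi> else prepend A [b]) =
      (if b = a then prepend A [a] \<circ>\<^sub>m (\<phi> \<circ>\<^sub>m \<psi>) else prepend A [b])"
      using assms \<open>b \<in> A\<close> by (simp add: below_comp_prepend hom_ident_comp)
  qed
  finally show ?thesis by simp
qed

text \<open>
  The two sides differ at the empty word, where only the left one is defined.
\<close>

lemma below_ident: "ev_eq A (ident A) (below A a (ident A))"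
proof -
  have "below A a (ident A) = branch A (\<lambda>b x. ident A (b # x))"
    unfolding below_def by (rule branch_cong)
      (auto simp: fun_eq_iff prepend_def restrict_map_def map_comp_def)
  then show ?thesis using ev_eq_branch_tails[of A "ident A"] by simp
qed

lemma ev_eq_below:
  assumes "finite A" "tame A \<phi>" "ev_eq A \<phi> \<psi>"
  shows "ev_eq A (below A a \<phi>) (below A a \<psi>)"
  unfolding below_def using assms
  by (auto intro!: ev_eq_branch ev_eq_comp ev_eq_refl)

text \<open>
  Words below \<open>a b\<close> are carried below \<open>a\<close>, acted on there, and carried back; every other word of
  the domain spends the middle step below \<open>c\<close>, where \<open>below A a \<phi>\<close> is the identity. The conjugating maps do not depend
  on \<open>\<phi>\<close>, which keeps the generating set finite.
\<close>

lemma below_below: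
  assumes A: "a \<in> A" "b \<in> A" "c \<in> A" "c \<noteq> a" and hom: "right_ideal_hom A \<phi>"
  shows "below A a (below A b \<phi>) = zoom_out A a b c \<circ>\<^sub>m (below A a \<phi> \<circ>\<^sub>m zoom_in A a b c)"
proof -
  let ?Z = "zoom_out A a b c"
  have Za: "?Z \<circ>\<^sub>m prepend A [a] = prepend A [a, b]"
    using A by (simp add: zoom_out_def branch_comp_prepend prepend_comp_prepend)
  have Zc: "?Z \<circ>\<^sub>m prepend A [c, a, e] = prepend A [a, e]" "?Z \<circ>\<^sub>m prepend A [c, c, e] = prepend A [e]"
    if "e \<in> A" for e
    using A that by (simp_all add: zoom_out_def branch_comp_prepend prepend_comp_prepend)
  have Ba: "below A a \<phi> \<circ>\<^sub>m prepend A [a] = prepend A [a] \<circ>\<^sub>m \<phi>"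
    using A hom by (simp add: below_comp_prepend map_comp_assoc hom_ident_comp flip: ident_eq_prepend)
  have Bc: "below A a \<phi> \<circ>\<^sub>m prepend A [c, d, e] = prepend A [c, d, e]" if "d \<in> A" "e \<in> A" for d e
    using A that by (simp add: below_comp_prepend)
  have Zb: "?Z \<circ>\<^sub>m (below A a \<phi> \<circ>\<^sub>m prepend A [a]) = prepend A [a, b] \<circ>\<^sub>m \<phi>"
    unfolding Ba by (simp add: Za flip: map_comp_assoc)
  have "?Z \<circ>\<^sub>m (below A a \<phi> \<circ>\<^sub>m zoom_in A a b c) =
    branch A (\<lambda>d. ?Z \<circ>\<^sub>m (below A a \<phi> \<circ>\<^sub>m (if d = a
      then branch A (\<lambda>e. if e = b then prepend A [a] else prepend A [c, a, e])
      else prepend A [c, c, d])))"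
    by (simp add: zoom_in_def comp_branch)
  also have "\<dots> = below A a (below A b \<phi>)"
    unfolding below_def[of A a "below A b \<phi>"]
  proof (rule branch_cong)
    fix d assume d: "d \<in> A"
    have "branch A (\<lambda>e. ?Z \<circ>\<^sub>m (below A a \<phi> \<circ>\<^sub>m (if e = b then prepend A [a] else prepend A [c, a, e]))) =
      branch A (\<lambda>e. prepend A [a] \<circ>\<^sub>m (if e = b then prepend A [b] \<circ>\<^sub>m \<phi> else prepend A [e]))"
    proof (rule branch_cong)
      fix e assume e: "e \<in> A"
      show "?Z \<circ>\<^sub>m (below A a \<phi> \<circ>\<^sub>m (if e = b then prepend A [a] else prepend A [c, a, e])) =
        prepend A [a] \<circ>\<^sub>m (if e = b then prepend A [b] \<circ>\<^sub>m \<phi> else prepend A [e])"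
        using A e by (simp add: Zb Bc Zc prepend_comp_prepend prepend_comp_prepend_comp)
    qed
    then show "?Z \<circ>\<^sub>m (below A a \<phi> \<circ>\<^sub>m (if d = a
        then branch A (\<lambda>e. if e = b then prepend A [a] else prepend A [c, a, e])
        else prepend A [c, c, d])) =
      (if d = a then prepend A [a] \<circ>\<^sub>m below A b \<phi> else prepend A [d])"
      using A d Bc[of c d] Zc[of d] by (simp add: comp_branch below_def)
  qed
  finally show ?thesis by simp
qed

section \<open>Finite generation\<close>

text \<open>
  Closing under eventual equality as well as composition lets generation be argued with tables
  throughout; \<open>max_ext\<close> does not see the difference (\<open>max_ext_hom_closure\<close>).
\<close>

inductive_set hom_closure :: "'a set \<Rightarrow> ('a list \<Rightarrow> 'a list option) set \<Rightarrow> ('a list \<Rightarrow> 'a list option) set"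
  for A S where
  ident: "ident A \<in> hom_closure A S"
| incl: "\<phi> \<in> S \<Longrightarrow> \<phi> \<in> hom_closure A S"
| comp: "\<phi> \<in> hom_closure A S \<Longrightarrow> \<psi> \<in> hom_closure A S \<Longrightarrow> \<phi> \<circ>\<^sub>m \<psi> \<in> hom_closure A S"
| ev: "\<phi> \<in> hom_closure A S \<Longrightarrow> ev_eq A \<phi> \<psi> \<Longrightarrow> tame A \<psi> \<Longrightarrow> \<psi> \<in> hom_closure A S"

lemma hom_closure_tame:
  assumes "\<And>\<phi>. \<phi> \<in> S \<Longrightarrow> tame A \<phi>" "\<phi> \<in> hom_closure A S"
  shows "tame A \<phi>"
  using assms(2) by induction (auto intro: tame_ident tame_comp assms(1))

lemma max_ext_hom_closure:
  assumes A: "A \<noteq> {}" and S: "\<And>\<phi>. \<phi> \<in> S \<Longrightarrow> tame A \<phi>" and \<phi>: "\<phi> \<in> hom_closure A S"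
  shows "max_ext A \<phi> \<in> submonoid_generated (M1 A) (max_ext A ` S)"
  using \<phi>
proof induction
  case ident
  then show ?case using submonoid_generated.one[of "M1 A"] by (simp add: one_M1)
next
  case (incl \<phi>)
  then show ?case by (intro submonoid_generated.incl imageI)
next
  case (comp \<phi> \<psi>)
  then have "tame A \<phi>" "tame A \<psi>" using hom_closure_tame[OF S] by blast+
  from mult_M1[OF A this] show ?case
    using submonoid_generated.mult[OF comp.IH] by simp
next
  case (ev \<phi> \<psi>)
  then have "tame A \<phi>" using hom_closure_tame[OF S] by blast
  from max_ext_cong[OF A this ev.hyps(3,2)] show ?case using ev.IH by simp
qed

lemma finitely_generated_M1I:
  assumes A: "finite A" "A \<noteq> {}" and fin: "finite S"
    and S: "\<And>\<phi>. \<phi> \<in> S \<Longrightarrow> tame A \<phi>" and all: "\<And>\<phi>. tame A \<phi> \<Longrightarrow> \<phi> \<in> hom_closure A S"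
  shows "finitely_generated_monoid (M1 A)"
proof -
  interpret monoid "M1 A" by (rule monoid_M1[OF A])
  have sub: "max_ext A ` S \<subseteq> carrier (M1 A)" using S by (auto simp: carrier_M1[OF A(1)])
  have "x \<in> carrier (M1 A)" if "x \<in> submonoid_generated (M1 A) (max_ext A ` S)" for x
    using that by induction (use sub in auto)
  moreover have "x \<in> submonoid_generated (M1 A) (max_ext A ` S)" if "x \<in> carrier (M1 A)" for x
    using that max_ext_hom_closure[OF A(2) S all] by (auto simp: carrier_M1[OF A(1)])
  ultimately have "submonoid_generated (M1 A) (max_ext A ` S) = carrier (M1 A)" by blast
  then show ?thesis
    using fin sub monoid_axioms unfolding finitely_generated_monoid_def by blast
qed

lemma below_in_hom_closure:
  assumes A: "finite A" "a \<in> A" and S: "\<And>\<phi>. \<phi> \<in> S \<Longrightarrow> tame A \<phi>"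
    and below_S: "\<And>\<phi>. \<phi> \<in> S \<Longrightarrow> below A a \<phi> \<in> hom_closure A S"
    and \<phi>: "\<phi> \<in> hom_closure A S"
  shows "below A a \<phi> \<in> hom_closure A S"
  using \<phi>
proof induction
  case ident
  show ?case
    by (rule hom_closure.ev[OF hom_closure.ident below_ident tame_below[OF A(1) tame_ident]])
next
  case (incl \<phi>)
  then show ?case by (rule below_S)
next
  case (comp \<phi> \<psi>)
  then have "below A a (\<phi> \<circ>\<^sub>m \<psi>) = below A a \<phi> \<circ>\<^sub>m below A a \<psi>"
    using below_comp[OF A(2)] tame_hom hom_closure_tame[OF S] by blast
  then show ?case using hom_closure.comp[OF comp.IH] by simp
next
  case (ev \<phi> \<psi>)
  then have "tame A \<phi>" using hom_closure_tame[OF S] by blast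
  with ev show ?case
    using ev_eq_below[OF A(1)] tame_below[OF A(1)] hom_closure.ev by blast
qed

text \<open>
  The letters are treated one at a time: \<open>?P B\<close> keeps the first letter \<open>b\<close> and acts as \<open>F b\<close> on
  the rest if \<open>b \<in> B\<close>, and it is the identity below the other letters. Composing with
  \<open>below A a (F a)\<close> adds \<open>a\<close> to \<open>B\<close>, since the kept first letter separates the actions. Deleting
  that letter after all of \<open>A\<close> has been treated gives \<open>branch A F\<close>.
\<close>

lemma branch_in_hom_closure:
  assumes A: "finite A"
    and fold: "branch A (\<lambda>_. ident A) \<in> hom_closure A S"
    and S: "\<And>\<phi>. \<phi> \<in> S \<Longrightarrow> tame A \<phi>"
    and below: "\<And>a \<phi>. a \<in> A \<Longrightarrow> \<phi> \<in> hom_closure A S \<Longrightarrow> below A a \<phi> \<in> hom_closure A S"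
    and F: "\<And>a. a \<in> A \<Longrightarrow> F a \<in> hom_closure A S"
  shows "branch A F \<in> hom_closure A S"
proof -
  have hom: "right_ideal_hom A (F a)" if "a \<in> A" for a
    using F[OF that] hom_closure_tame[OF S] tame_hom by blast
  let ?P = "\<lambda>B. branch A (\<lambda>b. if b \<in> B then prepend A [b] \<circ>\<^sub>m F b else prepend A [b])"
  have "?P B \<in> hom_closure A S" if "finite B" "B \<subseteq> A" for B
    using that
  proof induction
    case empty
    have "branch A (\<lambda>b. prepend A [b]) = branch A (\<lambda>b x. ident A (b # x))"
      by (rule branch_cong) (auto simp: fun_eq_iff prepend_def restrict_map_def)
    then have "ev_eq A (ident A) (?P {})" using ev_eq_branch_tails[of A "ident A"] by simp
    moreover have "tame A (?P {})" using A by (auto intro!: tame_branch tame_prepend)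
    ultimately show ?case by (rule hom_closure.ev[OF hom_closure.ident])
  next
    case (insert a B)
    then have a: "a \<in> A" by simp
    have "below A a (F a) \<circ>\<^sub>m ?P B = ?P (insert a B)"
      unfolding comp_branch
    proof (rule branch_cong)
      fix b assume b: "b \<in> A"
      have "below A a (F a) \<circ>\<^sub>m (prepend A [b] \<circ>\<^sub>m F b) = prepend A [b] \<circ>\<^sub>m F b" if "b \<in> B"
        using that insert.hyps a b by (auto simp: below_comp_prepend simp flip: map_comp_assoc)
      moreover have "below A a (F a) \<circ>\<^sub>m prepend A [a] = prepend A [a] \<circ>\<^sub>m F a"
        using a hom[OF a]
        by (simp add: below_comp_prepend map_comp_assoc hom_ident_comp flip: ident_eq_prepend)
      ultimately show "below A a (F a) \<circ>\<^sub>m (if b \<in> B then prepend A [b] \<circ>\<^sub>m F b else prepend A [b]) =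
        (if b \<in> insert a B then prepend A [b] \<circ>\<^sub>m F b else prepend A [b])"
        using a b insert.hyps by (auto simp: below_comp_prepend)
    qed
    moreover have "?P B \<in> hom_closure A S" using insert by auto
    ultimately show ?case using hom_closure.comp[OF below[OF a F[OF a]], of "?P B"] by simp
  qed
  from hom_closure.comp[OF fold this[OF A subset_refl]]
  have "branch A (\<lambda>b. branch A (\<lambda>_. ident A) \<circ>\<^sub>m (if b \<in> A then prepend A [b] \<circ>\<^sub>m F b else prepend A [b]))
    \<in> hom_closure A S"
    by (simp add: comp_branch)
  also have "branch A (\<lambda>b. branch A (\<lambda>_. ident A) \<circ>\<^sub>m (if b \<in> A then prepend A [b] \<circ>\<^sub>m F b else prepend A [b]))
    = branch A F"
  proof (rule branch_cong)
    fix b assume b: "b \<in> A"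
    have "branch A (\<lambda>_. ident A) \<circ>\<^sub>m prepend A [b] = ident A"
      using b by (simp add: branch_comp_prepend ident_eq_prepend prepend_comp_prepend)
    then show "branch A (\<lambda>_. ident A) \<circ>\<^sub>m (if b \<in> A then prepend A [b] \<circ>\<^sub>m F b else prepend A [b]) = F b"
      using b hom[OF b] by (simp add: hom_ident_comp flip: map_comp_assoc)
  qed
  finally show ?thesis .
qed

theorem theorem3p5:
  fixes A :: "'a set" and k :: nat
  assumes "k \<ge> 2" and "finite A" and "card A = k"
  shows "finitely_generated_monoid (M1 A)"
proof -
  note A = \<open>finite A\<close>
  have ne: "A \<noteq> {}" using assms by auto
  have other: "\<exists>c\<in>A. c \<noteq> a" for a
  proof (rule ccontr)
    assume "\<not> (\<exists>c\<in>A. c \<noteq> a)"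
    then have "card A \<le> card {a}" by (intro card_mono) auto
    with assms show False by simp
  qed
  define T where "T = {Map.empty, branch A (\<lambda>_. ident A)} \<union>
    (\<Union>a\<in>A. insert (prepend A [a]) (\<Union>b\<in>A. \<Union>c\<in>A. {zoom_in A a b c, zoom_out A a b c}))"
  define S where "S = T \<union> (\<Union>a\<in>A. below A a ` T)"
  have "finite S" using A by (simp add: S_def T_def)
  have T: "tame A \<phi>" if "\<phi> \<in> T" for \<phi>
    using that A by (auto simp: T_def intro!: tame_empty tame_branch tame_ident tame_prepend tame_zoom)
  then have S: "tame A \<phi>" if "\<phi> \<in> S" for \<phi>
    using that A by (auto simp: S_def intro!: tame_below)
  have below_T: "below A a \<phi> \<in> hom_closure A S" if "a \<in> A" "\<phi> \<in> T" for a \<phi>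
    using that by (intro hom_closure.incl) (auto simp: S_def)
  have "below A a \<phi> \<in> hom_closure A S" if a: "a \<in> A" and \<phi>: "\<phi> \<in> S" for a \<phi>
  proof (cases "\<phi> \<in> T")
    case True
    then show ?thesis using a below_T by blast
  next
    case False
    then obtain b \<psi> where b: "b \<in> A" "\<psi> \<in> T" "\<phi> = below A b \<psi>" using \<phi> by (auto simp: S_def)
    obtain c where c: "c \<in> A" "c \<noteq> a" using other by blast
    have "{zoom_in A a b c, zoom_out A a b c} \<subseteq> S"
      unfolding S_def T_def using a b(1) c(1) by blast
    then have zoom: "zoom_in A a b c \<in> hom_closure A S" "zoom_out A a b c \<in> hom_closure A S"
      by (auto intro: hom_closure.incl)
    have "\<phi> = below A b \<psi>" by (rule b(3))
    then show ?thesis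
      using below_below[OF a b(1) c tame_hom[OF T[OF b(2)]]]
        hom_closure.comp[OF zoom(2) hom_closure.comp[OF below_T[OF a b(2)] zoom(1)]]
      by simp
  qed
  then have below: "below A a \<phi> \<in> hom_closure A S" if "a \<in> A" "\<phi> \<in> hom_closure A S" for a \<phi>
    using that below_in_hom_closure[OF A] S by blast
  have fold: "branch A (\<lambda>_. ident A) \<in> hom_closure A S" and empty: "Map.empty \<in> hom_closure A S"
    by (auto simp: S_def T_def intro: hom_closure.incl)
  have prepend: "prepend A u \<in> hom_closure A S" if "u \<in> lists A" for u
    using that
  proof induction
    case Nil
    show ?case using hom_closure.ident[of A S] by (simp add: ident_eq_prepend)
  next
    case (Cons a u)
    have "prepend A [a] \<in> hom_closure A S"
      using Cons by (auto simp: S_def T_def intro: hom_closure.incl)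
    from hom_closure.comp[OF this Cons.IH] show ?case using Cons by (simp add: prepend_comp_prepend)
  qed
  \<comment> \<open>Reading the first letter lowers the depth by one.\<close>
  have "\<phi> \<in> hom_closure A S" if "decided_at A n \<phi>" for n \<phi>
    using that
  proof (induction n arbitrary: \<phi>)
    case 0
    then show ?case using decided_at_0 empty prepend by blast
  next
    case (Suc n)
    have "branch A (\<lambda>a x. \<phi> (a # x)) \<in> hom_closure A S"
      by (rule branch_in_hom_closure[OF A fold S below Suc.IH[OF decided_at_tail[OF Suc.prems]]])
    moreover have "tame A \<phi>" using Suc.prems by (auto simp: tame_def)
    ultimately show ?case using hom_closure.ev ev_eq_sym[OF ev_eq_branch_tails] by blast
  qed
  then show ?thesis
    using finitely_generated_M1I[OF A ne \<open>finite S\<close> S] unfolding tame_def by blast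
qed

end
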